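(* For all positive integers $n$ and $r$, the basic $r$-symmetric tropical polynomials $b_c$ ($c\in\mathbb{N}^r$, $|c|\le n$) generate the semifield of $S_n$-invariant tropical rational functions on $\mathbb{R}^{n\times r}$.
   Context: $\mathbb{N}=\{0,1,2,\dots\}$. The symmetric group $S_n$ acts on $\mathbb{R}^{n\times r}$ ($n\times r$ real matrices) by permuting rows. For $M=(m_{i\alpha})\in\mathbb{R}^{n\times r}$ and $c=(c_1,\dots,c_r)\in\mathbb{N}^r$ with $0<|c|:=c_1+\cdots+c_r\le n$, the basic $r$-symmetric tropical polynomial (basic value) is $$b_c(M)=\max\Bigl\{\sum_{\alpha=1}^r\sum_{i\in I_\alpha} m_{i\alpha} : I_1,\dots,I_r\subseteq\{1,\dots,n\}\text{ pairwise disjoint},\ \#I_\alpha=c_\alpha\Bigr\},$$ and $b_0(M)=0$. Put $K=\binom{n+r}{r}-1$ and $\Phi=(b_c)_{0<|c|\le n}:\mathbb{R}^{n\times r}\to\mathbb{R}^K$. A tropical polynomial on $\mathbb{R}^m$ is a finite maximum of functions $z\mapsto \gamma+\sum_i a_iz_i$ with $\gamma\in\mathbb{R}$, $a\in\mathbb{Z}_{\ge0}^m$. A tropical rational function on $\mathbb{R}^m$ is a difference of two tropical polynomials, regarded as a function $\mathbb{R}^m\to\mathbb{R}$ (two expressions are identified if they agree as functions). These functions form a semifield under the operations $\max$ (addition), $+$ (multiplication), $-$ (division). The sub-semifield generated by the basic values is $\{g\circ\Phi : g \text{ tropical rational on }\mathbb{R}^K\}$; thus "the basic polynomials generate" means that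 every $S_n$-invariant tropical rational $f$ on $\mathbb{R}^{n\times r}$ has the form $f=g\circ\Phi$ for some tropical rational $g$ on $\mathbb{R}^K$. *)

theory Defs
  imports Complex_Main "HOL-Library.Disjoint_Sets" "HOL-Combinatorics.Permutations"
begin

text \<open>
  For a finite index set I, a point of \<open>\<real>\<^sup>I\<close> is given by any function \<open>'i \<Rightarrow> real\<close>, its values
  outside I being ignored. The functions below read only the coordinates in I, so equality of
  tropical polynomials or rational functions as HOL functions is equality as functions on \<open>\<real>\<^sup>I\<close>.
\<close>

definition tropical_polynomial :: "'i set \<Rightarrow> (('i \<Rightarrow> real) \<Rightarrow> real) \<Rightarrow> bool" where
  "tropical_polynomial I p \<longleftrightarrow>
     (\<exists>T :: (real \<times> ('i \<Rightarrow> nat)) set. finite T \<and> T \<noteq> {} \<and>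
        p = (\<lambda>z. Max ((\<lambda>(\<gamma>, a). \<gamma> + (\<Sum>i\<in>I. real (a i) * z i)) ` T)))"

definition tropical_rational :: "'i set \<Rightarrow> (('i \<Rightarrow> real) \<Rightarrow> real) \<Rightarrow> bool" where
  "tropical_rational I f \<longleftrightarrow>
     (\<exists>p q. tropical_polynomial I p \<and> tropical_polynomial I q \<and> f = (\<lambda>z. p z - q z))"

text \<open>
  An \<open>n \<times> r\<close> matrix is a point of \<open>\<real>\<^sup>I\<close> for \<open>I = {..<n} \<times> {..<r}\<close>; rows and columns are
  numbered from 0, and \<open>M (i, \<alpha>)\<close> is the entry in row i and column \<open>\<alpha>\<close>.
\<close>

definition row_invariant :: "nat \<Rightarrow> ((nat \<times> nat \<Rightarrow> real) \<Rightarrow> real) \<Rightarrow> bool" where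
  "row_invariant n f \<longleftrightarrow>
     (\<forall>\<pi>. \<pi> permutes {..<n} \<longrightarrow> (\<forall>M. f (\<lambda>(i, \<alpha>). M (\<pi> i, \<alpha>)) = f M))"

definition basic_value :: "nat \<Rightarrow> nat \<Rightarrow> (nat \<Rightarrow> nat) \<Rightarrow> (nat \<times> nat \<Rightarrow> real) \<Rightarrow> real" where
  "basic_value n r c M =
     Max {\<Sum>\<alpha><r. \<Sum>i\<in>J \<alpha>. M (i, \<alpha>) | J :: nat \<Rightarrow> nat set.
       (\<forall>\<alpha><r. J \<alpha> \<subseteq> {..<n} \<and> card (J \<alpha>) = c \<alpha>) \<and> disjoint_family_on J {..<r}}"

text \<open>
  A vector \<open>c \<in> \<nat>\<^sup>r\<close> is encoded as a function vanishing from r on, so that each vector occurs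
  exactly once. The set below has \<open>K = ((n + r) choose r) - 1\<close> elements and indexes the
  coordinates of \<open>\<real>\<^sup>K\<close>.
\<close>

definition basic_indices :: "nat \<Rightarrow> nat \<Rightarrow> (nat \<Rightarrow> nat) set" where
  "basic_indices n r =
     {c. (\<forall>\<alpha>\<ge>r. c \<alpha> = 0) \<and> 0 < (\<Sum>\<alpha><r. c \<alpha>) \<and> (\<Sum>\<alpha><r. c \<alpha>) \<le> n}"

definition basic_map :: "nat \<Rightarrow> nat \<Rightarrow> (nat \<times> nat \<Rightarrow> real) \<Rightarrow> ((nat \<Rightarrow> nat) \<Rightarrow> real)" where
  "basic_map n r M = (\<lambda>c. if c \<in> basic_indices n r then basic_value n r c M else 0)"

definition invariant_semifield :: "nat \<Rightarrow> nat \<Rightarrow> ((nat \<times> nat \<Rightarrow> real) \<Rightarrow> real) set" where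
  "invariant_semifield n r = {f. tropical_rational ({..<n} \<times> {..<r}) f \<and> row_invariant n f}"

text \<open>The sub-semifield, containing the real constants, generated by the basic values.\<close>

definition basic_semifield :: "nat \<Rightarrow> nat \<Rightarrow> ((nat \<times> nat \<Rightarrow> real) \<Rightarrow> real) set" where
  "basic_semifield n r = {g \<circ> basic_map n r | g. tropical_rational (basic_indices n r) g}"

end

theory Submission imports Defs begin

text \<open>
  Read a matrix \<open>M\<close> as a multiset of n points of \<open>\<real>\<^sup>r\<close>, its rows, and give the row \<open>i\<close> the
  tropical linear form \<open>l \<mapsto> max (0, max\<^sub>\<beta> (M (i, \<beta>) + l \<beta>))\<close>, called \<open>hinge\<close> below. Expanding the
  tropical product of these forms, which is a sum of maxima, yields the basic values as coefficients:
  \<open>(\<Sum>i<n. hinge r M l i)\<close> is the maximum over c of \<open>basic_value n r c M + (\<Sum>\<alpha><r. c \<alpha> * l \<alpha>)\<close>.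
  Two facts follow from this.

  Reconstruction (\<open>row_eq_basic_differences\<close>): evaluate at \<open>l = - M (i, _)\<close>. There the i-th form is
  attained in all columns and by the term 0 at once, so that for some vector c the monomials c and
  \<open>c + e\<^sub>\<alpha>\<close> all attain the maximum, whence \<open>M (i, \<alpha>) = b\<^sub>c\<^sub>+\<^sub>e\<^sub>\<alpha> (M) - b\<^sub>c (M)\<close>. Thus every row of M is an
  integral linear function of the basic values, taken from a finite list; which entry of the list
  is right depends on M.

  Stability (\<open>near_matching\<close>): if all basic values of M and M' differ by at most \<open>\<epsilon>\<close>, then so
  do the two products, at every point l. A row of least coordinate sum among the rows of both
  matrices can then be matched with a row of the other matrix at distance \<open>O(\<epsilon>)\<close> (\<open>near_row\<close>);
  removing the pair changes the products by \<open>O(\<epsilon>)\<close>, so one can continue. Hence M and M' agree up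
  to a row permutation and an error \<open>O(\<epsilon>)\<close>, and an invariant tropical rational f, being
  Lipschitz, satisfies \<open>f M' \<le> f M + N * (\<Sum>c. \<bar>b\<^sub>c (M) - b\<^sub>c (M')\<bar>)\<close> for some natural number N.

  Now let \<open>D\<^sub>\<tau> (y)\<close> range over the finitely many matrices whose rows are read off from y by the
  reconstruction formula, and set
  \<open>g y = max\<^sub>\<tau> (f (D\<^sub>\<tau> (y)) - N * (\<Sum>c. \<bar>y c - b\<^sub>c (D\<^sub>\<tau> (y))\<bar>))\<close>.
  This is tropical rational with integral slopes. At \<open>y = \<Phi> (M)\<close>, stability bounds every term by
  \<open>f M\<close>, and a \<open>\<tau>\<close> with \<open>D\<^sub>\<tau> (y) = M\<close> attains this bound, so \<open>f = g \<circ> \<Phi>\<close>. It is the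
  extension formula of McShane, with the penalty term selecting the correct candidates.
\<close>

section \<open>Tropical rational functions form a semifield\<close>

abbreviation affine_term :: "'i set \<Rightarrow> ('i \<Rightarrow> real) \<Rightarrow> real \<times> ('i \<Rightarrow> nat) \<Rightarrow> real" where
  "affine_term I z \<equiv> \<lambda>(\<gamma>, a). \<gamma> + (\<Sum>i\<in>I. real (a i) * z i)"

text \<open>Distributivity of tropical multiplication over tropical sums.\<close>

lemma Max_image_plus_Max_image:
  fixes f g :: "_ \<Rightarrow> real"
  assumes "finite A" "A \<noteq> {}" "finite B" "B \<noteq> {}"
  shows "Max (f ` A) + Max (g ` B) = Max ((\<lambda>(x, y). f x + g y) ` (A \<times> B))"
proof (rule sym, rule Max_eqI)
  show "finite ((\<lambda>(x, y). f x + g y) ` (A \<times> B))"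
    using assms by simp
  fix w assume "w \<in> (\<lambda>(x, y). f x + g y) ` (A \<times> B)"
  then obtain x y where "x \<in> A" "y \<in> B" "w = f x + g y" by auto
  then show "w \<le> Max (f ` A) + Max (g ` B)"
    using assms by (simp add: add_mono)
next
  have "Max (f ` A) \<in> f ` A" "Max (g ` B) \<in> g ` B"
    using assms by (auto intro!: Max_in)
  then obtain x y where "x \<in> A" "y \<in> B" "Max (f ` A) = f x" "Max (g ` B) = g y" by auto
  then show "Max (f ` A) + Max (g ` B) \<in> (\<lambda>(x, y). f x + g y) ` (A \<times> B)"
    by force
qed

lemma tropical_polynomial_const: "tropical_polynomial I (\<lambda>z. k)"
  unfolding tropical_polynomial_def by (rule exI[of _ "{(k, \<lambda>_. 0)}"]) auto

lemma tropical_polynomial_coordinate: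
  assumes "finite I" "i \<in> I"
  shows "tropical_polynomial I (\<lambda>z. z i)"
proof -
  have "(\<Sum>j\<in>I. real (if j = i then 1 else 0) * z j) = z i" for z :: "_ \<Rightarrow> real"
  proof -
    have "(\<Sum>j\<in>I. real (if j = i then 1 else 0) * z j) = (\<Sum>j\<in>I. if j = i then z j else 0)"
      by (intro sum.cong) auto
    then show ?thesis using assms by simp
  qed
  then show ?thesis
    unfolding tropical_polynomial_def
    by (intro exI[of _ "{(0, \<lambda>j. if j = i then 1 else 0)}"]) auto
qed

lemma tropical_polynomial_add:
  assumes "tropical_polynomial I p" "tropical_polynomial I q"
  shows "tropical_polynomial I (\<lambda>z. p z + q z)"
proof -
  obtain S T where S: "finite S" "S \<noteq> {}" "p = (\<lambda>z. Max (affine_term I z ` S))"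
    and T: "finite T" "T \<noteq> {}" "q = (\<lambda>z. Max (affine_term I z ` T))"
    using assms unfolding tropical_polynomial_def by blast
  let ?plus = "\<lambda>(s, t). (fst s + fst t, \<lambda>i. snd s i + snd t i) :: real \<times> ('a \<Rightarrow> nat)"
  have "p z + q z = Max (affine_term I z ` ?plus ` (S \<times> T))" for z
    unfolding S T Max_image_plus_Max_image[OF S(1,2) T(1,2)] image_image
    by (rule arg_cong[where f = Max], rule image_cong)
       (auto simp: distrib_right sum.distrib)
  then show ?thesis
    unfolding tropical_polynomial_def using S T
    by (intro exI[of _ "?plus ` (S \<times> T)"]) auto
qed

lemma tropical_polynomial_max:
  assumes "tropical_polynomial I p" "tropical_polynomial I q"
  shows "tropical_polynomial I (\<lambda>z. max (p z) (q z))"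
proof -
  obtain S T where S: "finite S" "S \<noteq> {}" "p = (\<lambda>z. Max (affine_term I z ` S))"
    and T: "finite T" "T \<noteq> {}" "q = (\<lambda>z. Max (affine_term I z ` T))"
    using assms unfolding tropical_polynomial_def by blast
  have "max (p z) (q z) = Max (affine_term I z ` (S \<union> T))" for z
    unfolding S T image_Un using S T by (intro Max_Un[symmetric]) auto
  then show ?thesis
    unfolding tropical_polynomial_def using S T by (intro exI[of _ "S \<union> T"]) auto
qed

lemma tropical_rational_polynomial:
  "tropical_polynomial I p \<Longrightarrow> tropical_rational I p"
  unfolding tropical_rational_def
  by (rule exI[of _ p], rule exI[of _ "\<lambda>z. 0"]) (auto intro: tropical_polynomial_const)

lemma tropical_rational_const: "tropical_rational I (\<lambda>z. k)"
  by (intro tropical_rational_polynomial tropical_polynomial_const)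

lemma tropical_rational_coordinate:
  "finite I \<Longrightarrow> i \<in> I \<Longrightarrow> tropical_rational I (\<lambda>z. z i)"
  by (intro tropical_rational_polynomial tropical_polynomial_coordinate)

lemma tropical_rational_add:
  assumes "tropical_rational I f" "tropical_rational I g"
  shows "tropical_rational I (\<lambda>z. f z + g z)"
proof -
  obtain p q p' q' where *: "tropical_polynomial I p" "tropical_polynomial I q"
    "tropical_polynomial I p'" "tropical_polynomial I q'"
    and f: "f = (\<lambda>z. p z - q z)" and g: "g = (\<lambda>z. p' z - q' z)"
    using assms unfolding tropical_rational_def by blast
  have "(\<lambda>z. f z + g z) = (\<lambda>z. (p z + p' z) - (q z + q' z))"
    by (simp add: f g fun_eq_iff)
  then show ?thesis
    unfolding tropical_rational_def
    by (intro exI[of _ "\<lambda>z. p z + p' z"] exI[of _ "\<lambda>z. q z + q' z"])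
       (simp add: * tropical_polynomial_add)
qed

lemma tropical_rational_uminus:
  assumes "tropical_rational I f"
  shows "tropical_rational I (\<lambda>z. - f z)"
proof -
  obtain p q where *: "tropical_polynomial I p" "tropical_polynomial I q"
    and f: "f = (\<lambda>z. p z - q z)"
    using assms unfolding tropical_rational_def by blast
  have "(\<lambda>z. - f z) = (\<lambda>z. q z - p z)"
    by (simp add: f fun_eq_iff)
  then show ?thesis
    unfolding tropical_rational_def using * by blast
qed

lemma tropical_rational_diff:
  assumes "tropical_rational I f" "tropical_rational I g"
  shows "tropical_rational I (\<lambda>z. f z - g z)"
  using tropical_rational_add[OF assms(1) tropical_rational_uminus[OF assms(2)]] by simp

text \<open>Bring both quotients to the common tropical denominator \<open>q + q'\<close>.\<close>

lemma tropical_rational_max: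
  assumes "tropical_rational I f" "tropical_rational I g"
  shows "tropical_rational I (\<lambda>z. max (f z) (g z))"
proof -
  obtain p q p' q' where *: "tropical_polynomial I p" "tropical_polynomial I q"
    "tropical_polynomial I p'" "tropical_polynomial I q'"
    and f: "f = (\<lambda>z. p z - q z)" and g: "g = (\<lambda>z. p' z - q' z)"
    using assms unfolding tropical_rational_def by blast
  have "(\<lambda>z. max (f z) (g z)) = (\<lambda>z. max (p z + q' z) (p' z + q z) - (q z + q' z))"
    unfolding f g by (simp add: fun_eq_iff max_def)
  then show ?thesis
    unfolding tropical_rational_def
    by (intro exI[of _ "\<lambda>z. max (p z + q' z) (p' z + q z)"] exI[of _ "\<lambda>z. q z + q' z"])
       (simp add: * tropical_polynomial_add tropical_polynomial_max)
qed

lemma tropical_rational_abs: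
  assumes "tropical_rational I f"
  shows "tropical_rational I (\<lambda>z. \<bar>f z\<bar>)"
proof -
  have "(\<lambda>z. \<bar>f z\<bar>) = (\<lambda>z. max (f z) (- f z))"
    by (simp add: fun_eq_iff abs_real_def max_def)
  then show ?thesis
    using tropical_rational_max[OF assms tropical_rational_uminus[OF assms]] by simp
qed

lemma tropical_rational_sum:
  assumes "\<And>x. x \<in> A \<Longrightarrow> tropical_rational I (f x)"
  shows "tropical_rational I (\<lambda>z. \<Sum>x\<in>A. f x z)"
  using assms
  by (induction A rule: infinite_finite_induct)
     (auto intro: tropical_rational_const tropical_rational_add)

lemma tropical_rational_of_nat_mult:
  assumes "tropical_rational I f"
  shows "tropical_rational I (\<lambda>z. real k * f z)"
  using tropical_rational_sum[where A = "{..<k}" and f = "\<lambda>_. f", OF assms] by simp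

lemma tropical_rational_Max:
  assumes "finite A" "A \<noteq> {}" "\<And>x. x \<in> A \<Longrightarrow> tropical_rational I (f x)"
  shows "tropical_rational I (\<lambda>z. Max ((\<lambda>x. f x z) ` A))"
  using assms
  by (induction A rule: finite_ne_induct) (auto intro: tropical_rational_max)

text \<open>Substitution: a tropical polynomial is built from its arguments by sums, natural multiples,
  constants and maxima, all of which preserve tropical rationality.\<close>

lemma tropical_rational_compose:
  assumes g: "tropical_rational I g" and h: "\<And>i. i \<in> I \<Longrightarrow> tropical_rational J (\<lambda>z. h z i)"
  shows "tropical_rational J (\<lambda>z. g (h z))"
proof -
  have poly: "tropical_rational J (\<lambda>z. p (h z))" if p: "tropical_polynomial I p" for p
  proof -
    obtain T where T: "finite T" "T \<noteq> {}" "p = (\<lambda>z. Max (affine_term I z ` T))"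
      using p unfolding tropical_polynomial_def by blast
    have "tropical_rational J (\<lambda>z. affine_term I (h z) t)" for t
      by (cases t) (auto intro!: tropical_rational_add tropical_rational_const
          tropical_rational_sum tropical_rational_of_nat_mult h)
    then show ?thesis
      unfolding T by (intro tropical_rational_Max T)
  qed
  obtain p q where "tropical_polynomial I p" "tropical_polynomial I q"
    and "g = (\<lambda>z. p z - q z)"
    using g unfolding tropical_rational_def by blast
  then show ?thesis
    by (auto intro: tropical_rational_diff poly)
qed

lemma tropical_rational_cong:
  assumes "tropical_rational I f" "\<And>i. i \<in> I \<Longrightarrow> z i = z' i"
  shows "f z = f z'"
proof -
  have "p z = p z'" if "tropical_polynomial I p" for p
    using that assms(2) by (auto simp: tropical_polynomial_def)
  then show ?thesis
    using assms(1) unfolding tropical_rational_def by metis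
qed

text \<open>The sum of all exponents that occur is a common Lipschitz constant of the affine terms for
  the maximum norm.\<close>

lemma tropical_polynomial_Lipschitz:
  assumes "tropical_polynomial I p"
  shows "\<exists>L\<ge>0. \<forall>z z' s. (\<forall>i\<in>I. \<bar>z i - z' i\<bar> \<le> s) \<longrightarrow> p z \<le> p z' + L * s"
proof -
  obtain T where T: "finite T" "T \<noteq> {}" "p = (\<lambda>z. Max (affine_term I z ` T))"
    using assms unfolding tropical_polynomial_def by blast
  define L where "L = (\<Sum>t\<in>T. \<Sum>i\<in>I. real (snd t i))"
  have "p z \<le> p z' + L * s" if s: "\<forall>i\<in>I. \<bar>z i - z' i\<bar> \<le> s" for z z' s
  proof -
    have "affine_term I z t \<le> p z' + L * s" if t: "t \<in> T" for t
    proof -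
      have "(\<Sum>i\<in>I. real (snd t i) * z i) \<le> (\<Sum>i\<in>I. real (snd t i) * (z' i + s))"
        using s by (intro sum_mono mult_left_mono) fastforce+
      also have "\<dots> = (\<Sum>i\<in>I. real (snd t i) * z' i) + (\<Sum>i\<in>I. real (snd t i)) * s"
        by (simp add: distrib_left sum.distrib sum_distrib_right)
      \<comment> \<open>A negative \<open>s\<close> is possible only for empty \<open>I\<close>, where both factors vanish.\<close>
      also have "(\<Sum>i\<in>I. real (snd t i)) * s \<le> L * s"
      proof (cases "I = {} \<or> infinite I")
        case True then show ?thesis by (auto simp: L_def)
      next
        case False
        then have "0 \<le> s" using s by force
        moreover have "(\<Sum>i\<in>I. real (snd t i)) \<le> L"
          unfolding L_def using T t by (intro member_le_sum sum_nonneg) auto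
        ultimately show ?thesis by (rule mult_right_mono[rotated])
      qed
      finally have "affine_term I z t \<le> affine_term I z' t + L * s"
        by (simp add: case_prod_beta)
      also have "affine_term I z' t \<le> p z'"
        unfolding T(3) using T t by (intro Max_ge) auto
      finally show ?thesis by simp
    qed
    then show ?thesis
      using T by (subst T(3)) (intro Max.boundedI, auto)
  qed
  moreover have "0 \<le> L" unfolding L_def by (intro sum_nonneg) auto
  ultimately show ?thesis by blast
qed

lemma tropical_rational_Lipschitz:
  assumes "tropical_rational I f"
  obtains L where "L \<ge> 0"
    and "\<And>z z' s. (\<And>i. i \<in> I \<Longrightarrow> \<bar>z i - z' i\<bar> \<le> s) \<Longrightarrow> f z \<le> f z' + L * s"
proof -
  obtain p q where p: "tropical_polynomial I p" and q: "tropical_polynomial I q"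
    and f: "f = (\<lambda>z. p z - q z)"
    using assms unfolding tropical_rational_def by blast
  obtain K where K: "K \<ge> 0"
    "\<And>z z' s. (\<forall>i\<in>I. \<bar>z i - z' i\<bar> \<le> s) \<Longrightarrow> p z \<le> p z' + K * s"
    using tropical_polynomial_Lipschitz[OF p] by blast
  obtain L where L: "L \<ge> 0"
    "\<And>z z' s. (\<forall>i\<in>I. \<bar>z i - z' i\<bar> \<le> s) \<Longrightarrow> q z \<le> q z' + L * s"
    using tropical_polynomial_Lipschitz[OF q] by blast
  show ?thesis
  proof
    show "K + L \<ge> 0" using K L by simp
    fix z z' :: "'a \<Rightarrow> real" and s assume *: "\<And>i. i \<in> I \<Longrightarrow> \<bar>z i - z' i\<bar> \<le> s"
    have "p z \<le> p z' + K * s" using * by (intro K) blast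
    moreover have "q z' \<le> q z + L * s" using * by (intro L) (auto simp: abs_minus_commute)
    ultimately show "f z \<le> f z' + (K + L) * s"
      by (simp add: f distrib_right)
  qed
qed

section \<open>Basic values as optimal assignments\<close>

lemma finite_basic_indices: "finite (basic_indices n r)"
proof (rule finite_subset)
  show "finite {c. \<forall>\<alpha>. (\<alpha> \<in> {..<r} \<longrightarrow> c \<alpha> \<in> {..n}) \<and> (\<alpha> \<notin> {..<r} \<longrightarrow> c \<alpha> = 0)}"
    by (rule finite_set_of_finite_funs) auto
  have le: "c \<alpha> \<le> n" if "c \<in> basic_indices n r" "\<alpha> < r" for c \<alpha>
  proof -
    have "c \<alpha> \<le> (\<Sum>\<beta><r. c \<beta>)" using that by (intro member_le_sum) auto
    also have "\<dots> \<le> n" using that by (simp add: basic_indices_def)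
    finally show ?thesis .
  qed
  show "basic_indices n r
      \<subseteq> {c. \<forall>\<alpha>. (\<alpha> \<in> {..<r} \<longrightarrow> c \<alpha> \<in> {..n}) \<and> (\<alpha> \<notin> {..<r} \<longrightarrow> c \<alpha> = 0)}"
  proof (intro subsetI CollectI allI conjI impI)
    fix c \<alpha> assume c: "c \<in> basic_indices n r"
    show "c \<alpha> \<in> {..n}" if "\<alpha> \<in> {..<r}" using le c that by simp
    show "c \<alpha> = 0" if "\<alpha> \<notin> {..<r}" using c that by (simp add: basic_indices_def)
  qed
qed

definition disjoint_choices :: "nat \<Rightarrow> nat \<Rightarrow> (nat \<Rightarrow> nat) \<Rightarrow> (nat \<Rightarrow> nat set) set" where
  "disjoint_choices n r c = {J \<in> {..<r} \<rightarrow>\<^sub>E Pow {..<n}.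
     (\<forall>\<alpha><r. card (J \<alpha>) = c \<alpha>) \<and> disjoint_family_on J {..<r}}"

lemma finite_disjoint_choices: "finite (disjoint_choices n r c)"
proof (rule finite_subset)
  show "disjoint_choices n r c \<subseteq> {..<r} \<rightarrow>\<^sub>E Pow {..<n}"
    unfolding disjoint_choices_def by (rule Collect_restrict)
qed (simp add: finite_PiE)

lemma disjoint_choicesD:
  assumes "J \<in> disjoint_choices n r c"
  shows "\<alpha> < r \<Longrightarrow> J \<alpha> \<subseteq> {..<n}" "\<alpha> < r \<Longrightarrow> card (J \<alpha>) = c \<alpha>"
    "disjoint_family_on J {..<r}"
  using assms by (simp_all add: disjoint_choices_def PiE_iff)

lemma restrict_in_disjoint_choices:
  assumes "\<And>\<alpha>. \<alpha> < r \<Longrightarrow> J \<alpha> \<subseteq> {..<n}" "\<And>\<alpha>. \<alpha> < r \<Longrightarrow> card (J \<alpha>) = c \<alpha>"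
    and "disjoint_family_on J {..<r}"
  shows "restrict J {..<r} \<in> disjoint_choices n r c"
  using assms by (simp add: disjoint_choices_def disjoint_family_on_def)

text \<open>The family J in the definition of a basic value is arbitrary outside the columns;
  restricting it there makes the maximum range over a finite set.\<close>

lemma basic_value_eq_Max:
  "basic_value n r c M =
     Max ((\<lambda>J. \<Sum>\<alpha><r. \<Sum>i\<in>J \<alpha>. M (i, \<alpha>)) ` disjoint_choices n r c)"
proof -
  have "{\<Sum>\<alpha><r. \<Sum>i\<in>J \<alpha>. M (i, \<alpha>) | J :: nat \<Rightarrow> nat set.
       (\<forall>\<alpha><r. J \<alpha> \<subseteq> {..<n} \<and> card (J \<alpha>) = c \<alpha>) \<and> disjoint_family_on J {..<r}}
     = (\<lambda>J. \<Sum>\<alpha><r. \<Sum>i\<in>J \<alpha>. M (i, \<alpha>)) ` disjoint_choices n r c" (is "?L = ?R")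
  proof
    show "?R \<subseteq> ?L"
    proof
      fix w assume "w \<in> ?R"
      then obtain J where J: "J \<in> disjoint_choices n r c"
        and w: "w = (\<Sum>\<alpha><r. \<Sum>i\<in>J \<alpha>. M (i, \<alpha>))" by (rule imageE)
      show "w \<in> ?L"
        by (intro CollectI exI[of _ J] conjI w disjoint_choicesD(3)[OF J])
           (simp add: disjoint_choicesD[OF J])
    qed
    show "?L \<subseteq> ?R"
    proof
      fix w assume "w \<in> ?L"
      then obtain J where J: "\<forall>\<alpha><r. J \<alpha> \<subseteq> {..<n} \<and> card (J \<alpha>) = c \<alpha>"
        "disjoint_family_on J {..<r}" and w: "w = (\<Sum>\<alpha><r. \<Sum>i\<in>J \<alpha>. M (i, \<alpha>))"
        by blast
      have "restrict J {..<r} \<in> disjoint_choices n r c"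
        using J by (intro restrict_in_disjoint_choices) simp_all
      moreover have "w = (\<Sum>\<alpha><r. \<Sum>i\<in>restrict J {..<r} \<alpha>. M (i, \<alpha>))"
        unfolding w by (intro sum.cong) auto
      ultimately show "w \<in> ?R" by blast
    qed
  qed
  then show ?thesis unfolding basic_value_def by simp
qed

text \<open>Cut an initial segment of the rows into consecutive blocks of the prescribed sizes.\<close>

lemma disjoint_choices_nonempty:
  assumes "(\<Sum>\<alpha><r. c \<alpha>) \<le> n"
  shows "disjoint_choices n r c \<noteq> {}"
proof -
  define S where "S \<alpha> = (\<Sum>\<beta><\<alpha>. c \<beta>)" for \<alpha>
  define J where "J \<alpha> = {S \<alpha>..<S (Suc \<alpha>)}" for \<alpha>
  have mono: "S \<alpha> \<le> S \<beta>" if "\<alpha> \<le> \<beta>" for \<alpha> \<beta>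
    unfolding S_def using that by (intro sum_mono2) auto
  have le: "S (Suc \<alpha>) \<le> n" if "\<alpha> < r" for \<alpha>
    using mono[of "Suc \<alpha>" r] that assms by (simp add: S_def)
  have "J \<alpha> \<subseteq> {..<n}" if "\<alpha> < r" for \<alpha>
    using le[OF that] by (auto simp: J_def)
  moreover have "card (J \<alpha>) = c \<alpha>" for \<alpha>
    by (simp add: J_def S_def)
  moreover have "J \<alpha> \<inter> J \<beta> = {}" if "\<alpha> \<noteq> \<beta>" for \<alpha> \<beta>
  proof (cases "\<alpha> < \<beta>")
    case True
    then show ?thesis using mono[of "Suc \<alpha>" \<beta>] by (auto simp: J_def)
  next
    case False
    then show ?thesis using mono[of "Suc \<beta>" \<alpha>] that by (auto simp: J_def)
  qed
  then have "disjoint_family_on J {..<r}"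
    by (simp add: disjoint_family_on_def)
  ultimately have "restrict J {..<r} \<in> disjoint_choices n r c"
    by (intro restrict_in_disjoint_choices)
  then show ?thesis by blast
qed

lemma tropical_rational_basic_value:
  assumes "(\<Sum>\<alpha><r. c \<alpha>) \<le> n"
  shows "tropical_rational ({..<n} \<times> {..<r}) (basic_value n r c)"
proof -
  have "tropical_rational ({..<n} \<times> {..<r})
      (\<lambda>M. Max ((\<lambda>J. \<Sum>\<alpha><r. \<Sum>i\<in>J \<alpha>. M (i, \<alpha>)) ` disjoint_choices n r c))"
    by (intro tropical_rational_Max finite_disjoint_choices disjoint_choices_nonempty assms
        tropical_rational_sum tropical_rational_coordinate)
       (use disjoint_choicesD(1) in \<open>fastforce+\<close>)
  then show ?thesis
    by (simp add: basic_value_eq_Max[abs_def])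
qed

text \<open>A permutation maps choices to choices of the same sizes. This bounds the value at the permuted
  matrix by the value at the matrix itself; the inverse permutation gives equality.\<close>

lemma row_invariant_basic_value: "row_invariant n (basic_value n r c)"
proof -
  have le: "basic_value n r c (\<lambda>(i, \<alpha>). M (\<pi> i, \<alpha>)) \<le> basic_value n r c M"
    if \<pi>: "\<pi> permutes {..<n}" and ne: "disjoint_choices n r c \<noteq> {}" for \<pi> M
    unfolding basic_value_eq_Max
  proof (rule Max.boundedI)
    fix w assume "w \<in> (\<lambda>J. \<Sum>\<alpha><r. \<Sum>i\<in>J \<alpha>. (\<lambda>(i, \<alpha>). M (\<pi> i, \<alpha>)) (i, \<alpha>)) ` disjoint_choices n r c"
    then obtain J where J: "J \<in> disjoint_choices n r c"
      and w: "w = (\<Sum>\<alpha><r. \<Sum>i\<in>J \<alpha>. M (\<pi> i, \<alpha>))" by auto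
    have inj: "inj_on \<pi> A" for A
      using permutes_inj[OF \<pi>] by (auto intro: inj_on_subset)
    define J' where "J' = restrict (\<lambda>\<alpha>. \<pi> ` J \<alpha>) {..<r}"
    have "\<pi> ` J \<alpha> \<subseteq> {..<n}" if "\<alpha> < r" for \<alpha>
      using disjoint_choicesD(1)[OF J that] permutes_image[OF \<pi>] by (metis image_mono)
    moreover have "card (\<pi> ` J \<alpha>) = c \<alpha>" if "\<alpha> < r" for \<alpha>
      using disjoint_choicesD(2)[OF J that] by (simp add: card_image[OF inj])
    moreover have "disjoint_family_on (\<lambda>\<alpha>. \<pi> ` J \<alpha>) {..<r}"
      using disjoint_choicesD(3)[OF J]
      by (simp add: disjoint_family_on_def image_Int[OF permutes_inj[OF \<pi>], symmetric])
    ultimately have J': "J' \<in> disjoint_choices n r c"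
      unfolding J'_def by (rule restrict_in_disjoint_choices)
    have "w = (\<Sum>\<alpha><r. \<Sum>i\<in>J' \<alpha>. M (i, \<alpha>))"
      by (simp add: w J'_def sum.reindex[OF inj])
    with J' show "w \<le> Max ((\<lambda>J. \<Sum>\<alpha><r. \<Sum>i\<in>J \<alpha>. M (i, \<alpha>)) ` disjoint_choices n r c)"
      by (auto intro!: Max_ge finite_disjoint_choices)
  qed (use ne finite_disjoint_choices in auto)
  show ?thesis
    unfolding row_invariant_def
  proof (intro allI impI)
    fix \<pi> M assume \<pi>: "\<pi> permutes {..<n}"
    show "basic_value n r c (\<lambda>(i, \<alpha>). M (\<pi> i, \<alpha>)) = basic_value n r c M"
    proof (cases "disjoint_choices n r c = {}")
      case True then show ?thesis by (simp add: basic_value_eq_Max)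
    next
      case False
      have "basic_value n r c M \<le> basic_value n r c (\<lambda>(i, \<alpha>). M (\<pi> i, \<alpha>))"
        using le[OF permutes_inv[OF \<pi>] False, of "\<lambda>(i, \<alpha>). M (\<pi> i, \<alpha>)"]
        by (simp add: permutes_inverses[OF \<pi>])
      with le[OF \<pi> False] show ?thesis by (simp add: antisym)
    qed
  qed
qed

lemma basic_value_zero: "basic_value n r (\<lambda>_. 0) M = 0"
proof -
  have "(\<lambda>J. \<Sum>\<alpha><r. \<Sum>i\<in>J \<alpha>. M (i, \<alpha>)) ` disjoint_choices n r (\<lambda>_. 0) \<subseteq> {0}"
  proof clarsimp
    fix J assume J: "J \<in> disjoint_choices n r (\<lambda>_. 0)"
    have "J \<alpha> = {}" if "\<alpha> < r" for \<alpha>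
      using disjoint_choicesD(1,2)[OF J that] finite_subset by fastforce
    then show "(\<Sum>\<alpha><r. \<Sum>i\<in>J \<alpha>. M (i, \<alpha>)) = 0" by simp
  qed
  with disjoint_choices_nonempty[where c = "\<lambda>_. 0" and r = r and n = n]
  have "(\<lambda>J. \<Sum>\<alpha><r. \<Sum>i\<in>J \<alpha>. M (i, \<alpha>)) ` disjoint_choices n r (\<lambda>_. 0) = {0}"
    by (simp add: subset_singleton_iff)
  then show ?thesis by (simp add: basic_value_eq_Max)
qed

section \<open>The product of the tropical linear forms of the rows\<close>

text \<open>The tropical linear form of row \<open>i\<close>, evaluated at \<open>l\<close>. The entry 0 acts as an additional
  column, which takes the rows that a choice leaves out.\<close>

definition hinge :: "nat \<Rightarrow> (nat \<times> nat \<Rightarrow> real) \<Rightarrow> (nat \<Rightarrow> real) \<Rightarrow> nat \<Rightarrow> real" where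
  "hinge r M l i = Max (insert 0 ((\<lambda>\<beta>. M (i, \<beta>) + l \<beta>) ` {..<r}))"

lemma hinge_nonneg: "0 \<le> hinge r M l i"
  unfolding hinge_def by (intro Max_ge) auto

lemma hinge_ge: "\<beta> < r \<Longrightarrow> M (i, \<beta>) + l \<beta> \<le> hinge r M l i"
  unfolding hinge_def by (intro Max_ge) auto

lemma hinge_le: "0 \<le> w \<Longrightarrow> (\<And>\<beta>. \<beta> < r \<Longrightarrow> M (i, \<beta>) + l \<beta> \<le> w) \<Longrightarrow> hinge r M l i \<le> w"
  unfolding hinge_def by (intro Max.boundedI) auto

lemma hinge_attained: "\<exists>k. hinge r M l i = (if k < r then M (i, k) + l k else 0)"
proof -
  have "hinge r M l i \<in> insert 0 ((\<lambda>\<beta>. M (i, \<beta>) + l \<beta>) ` {..<r})"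
    unfolding hinge_def by (intro Max_in) auto
  then show ?thesis by (auto intro: exI[of _ r])
qed

lemma hinge_Lipschitz:
  assumes "0 \<le> s" "\<And>\<beta>. \<beta> < r \<Longrightarrow> M (i, \<beta>) + l \<beta> \<le> M' (j, \<beta>) + l' \<beta> + s"
  shows "hinge r M l i \<le> hinge r M' l' j + s"
proof (rule hinge_le)
  show "0 \<le> hinge r M' l' j + s" using hinge_nonneg[of r M' l' j] assms by simp
  fix \<beta> assume "\<beta> < r"
  then show "M (i, \<beta>) + l \<beta> \<le> hinge r M' l' j + s"
    using assms(2)[of \<beta>] hinge_ge[of \<beta> r M' j l'] by simp
qed

text \<open>Each monomial of the product is bounded by the product: an optimal choice for c picks a term
  of the linear form in the chosen rows and the term 0 in the others.\<close>

lemma basic_value_le_sum_hinge: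
  assumes "(\<Sum>\<alpha><r. c \<alpha>) \<le> n"
  shows "basic_value n r c M + (\<Sum>\<alpha><r. real (c \<alpha>) * l \<alpha>) \<le> (\<Sum>i<n. hinge r M l i)"
proof -
  have "basic_value n r c M
      \<in> (\<lambda>J. \<Sum>\<alpha><r. \<Sum>i\<in>J \<alpha>. M (i, \<alpha>)) ` disjoint_choices n r c"
    unfolding basic_value_eq_Max
    by (intro Max_in finite_imageI finite_disjoint_choices) (simp add: disjoint_choices_nonempty assms)
  then obtain J where J: "J \<in> disjoint_choices n r c"
    and b: "basic_value n r c M = (\<Sum>\<alpha><r. \<Sum>i\<in>J \<alpha>. M (i, \<alpha>))" by blast
  have sub: "J \<alpha> \<subseteq> {..<n}" "card (J \<alpha>) = c \<alpha>" if "\<alpha> < r" for \<alpha>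
    using disjoint_choicesD[OF J] that by auto
  have "basic_value n r c M + (\<Sum>\<alpha><r. real (c \<alpha>) * l \<alpha>)
      = (\<Sum>\<alpha><r. \<Sum>i\<in>J \<alpha>. M (i, \<alpha>) + l \<alpha>)"
    using sub by (simp add: b sum.distrib)
  also have "\<dots> \<le> (\<Sum>\<alpha><r. \<Sum>i\<in>J \<alpha>. hinge r M l i)"
    by (intro sum_mono hinge_ge) auto
  also have "\<dots> = (\<Sum>i\<in>(\<Union>\<alpha><r. J \<alpha>). hinge r M l i)"
    using disjoint_choicesD(3)[OF J] finite_subset[OF sub(1)]
    by (intro sum.UNION_disjoint[symmetric]) (simp_all add: disjoint_family_on_def)
  also have "\<dots> \<le> (\<Sum>i<n. hinge r M l i)"
    using sub by (intro sum_mono2 hinge_nonneg) auto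
  finally show ?thesis .
qed

text \<open>A function \<open>a\<close> assigns row j to column \<open>a j\<close>, and to no column if \<open>a j \<ge> r\<close>.\<close>

definition column_counts :: "nat \<Rightarrow> nat \<Rightarrow> (nat \<Rightarrow> nat) \<Rightarrow> (nat \<Rightarrow> nat)" where
  "column_counts n r a = (\<lambda>\<alpha>. if \<alpha> < r then card {j \<in> {..<n}. a j = \<alpha>} else 0)"

lemma sum_over_columns:
  fixes h :: "nat \<Rightarrow> nat \<Rightarrow> 'a::comm_monoid_add"
  shows "(\<Sum>\<alpha><r. \<Sum>j\<in>{j \<in> {..<n}. a j = \<alpha>}. h j \<alpha>) = (\<Sum>j<n. if a j < r then h j (a j) else 0)"
proof -
  have "(\<Sum>\<alpha><r. \<Sum>j\<in>{j \<in> {..<n}. a j = \<alpha>}. h j \<alpha>)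
      = (\<Sum>\<alpha><r. \<Sum>j<n. if a j = \<alpha> then h j \<alpha> else 0)"
    by (intro sum.cong refl sum.inter_filter) auto
  also have "\<dots> = (\<Sum>j<n. \<Sum>\<alpha><r. if a j = \<alpha> then h j \<alpha> else 0)"
    by (rule sum.swap)
  also have "\<dots> = (\<Sum>j<n. if a j < r then h j (a j) else 0)"
    by (intro sum.cong) (auto simp: sum.delta')
  finally show ?thesis .
qed

lemma sum_column_counts:
  "(\<Sum>\<alpha><r. column_counts n r a \<alpha>) = card {j \<in> {..<n}. a j < r}"
proof -
  have "(\<Sum>\<alpha><r. column_counts n r a \<alpha>) = (\<Sum>\<alpha><r. \<Sum>j\<in>{j \<in> {..<n}. a j = \<alpha>}. 1)"
    by (intro sum.cong) (auto simp: column_counts_def)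
  also have "\<dots> = (\<Sum>j<n. if a j < r then 1 else 0)"
    by (rule sum_over_columns)
  also have "\<dots> = card {j \<in> {..<n}. a j < r}"
    by (simp add: sum.If_cases Int_def)
  finally show ?thesis .
qed

lemma sum_column_counts_le: "(\<Sum>\<alpha><r. column_counts n r a \<alpha>) \<le> n"
proof -
  have "card {j \<in> {..<n}. a j < r} \<le> card {..<n}" by (intro card_mono) auto
  then show ?thesis by (simp add: sum_column_counts)
qed

text \<open>If \<open>a\<close> picks a maximal term in every row, then its monomial attains the value of the product.
  Every point \<open>l\<close> admits such an \<open>a\<close>, so together with the previous bound this is the expansion of
  the product with the basic values as coefficients.\<close>

lemma basic_value_tight:
  assumes "\<And>j. j < n \<Longrightarrow> hinge r M l j = (if a j < r then M (j, a j) + l (a j) else 0)"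
  shows "basic_value n r (column_counts n r a) M
      + (\<Sum>\<alpha><r. real (column_counts n r a \<alpha>) * l \<alpha>) = (\<Sum>j<n. hinge r M l j)"
proof (rule antisym)
  let ?J = "restrict (\<lambda>\<alpha>. {j \<in> {..<n}. a j = \<alpha>}) {..<r}"
  let ?c = "column_counts n r a"
  have "?J \<in> disjoint_choices n r ?c"
    by (intro restrict_in_disjoint_choices) (auto simp: column_counts_def disjoint_family_on_def)
  then have *: "(\<Sum>\<alpha><r. \<Sum>i\<in>?J \<alpha>. M (i, \<alpha>)) \<le> basic_value n r ?c M"
    unfolding basic_value_eq_Max by (intro Max_ge finite_imageI finite_disjoint_choices) blast
  have "(\<Sum>j<n. hinge r M l j) = (\<Sum>j<n. if a j < r then M (j, a j) + l (a j) else 0)"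
    using assms by (intro sum.cong) auto
  also have "\<dots> = (\<Sum>\<alpha><r. \<Sum>j\<in>{j \<in> {..<n}. a j = \<alpha>}. M (j, \<alpha>) + l \<alpha>)"
    by (rule sum_over_columns[symmetric])
  also have "\<dots> = (\<Sum>\<alpha><r. \<Sum>i\<in>?J \<alpha>. M (i, \<alpha>)) + (\<Sum>\<alpha><r. real (?c \<alpha>) * l \<alpha>)"
    by (simp add: sum.distrib column_counts_def)
  finally show "(\<Sum>j<n. hinge r M l j) \<le> basic_value n r ?c M + (\<Sum>\<alpha><r. real (?c \<alpha>) * l \<alpha>)"
    using * by simp
qed (rule basic_value_le_sum_hinge[OF sum_column_counts_le])

text \<open>The maximum of affine functions moves by at most \<open>\<epsilon>\<close> when their constants do. The vector 0 is
  not an index, but its basic value is 0 for both matrices.\<close>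

lemma sum_hinge_le_of_basic_values:
  assumes "0 \<le> \<epsilon>"
    and "\<And>c. c \<in> basic_indices n r \<Longrightarrow> basic_value n r c M \<le> basic_value n r c M' + \<epsilon>"
  shows "(\<Sum>i<n. hinge r M l i) \<le> (\<Sum>i<n. hinge r M' l i) + \<epsilon>"
proof -
  obtain a where a: "\<And>j. hinge r M l j = (if a j < r then M (j, a j) + l (a j) else 0)"
    using hinge_attained[of r M l] by metis
  let ?c = "column_counts n r a"
  have "basic_value n r ?c M \<le> basic_value n r ?c M' + \<epsilon>"
  proof (cases "?c \<in> basic_indices n r")
    case False
    then have "?c \<alpha> = 0" for \<alpha>
      using sum_column_counts_le[of n r a]
      by (cases "\<alpha> < r") (auto simp: basic_indices_def column_counts_def)
    then have "?c = (\<lambda>_. 0)" by auto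
    then show ?thesis using assms by (simp add: basic_value_zero)
  qed (use assms in auto)
  then show ?thesis
    using basic_value_tight[of n r M l a] basic_value_le_sum_hinge[OF sum_column_counts_le[of n r a], of M' l] a
    by simp
qed

text \<open>At \<open>l = - M (i, _)\<close> the terms of row \<open>i\<close> are all 0 and all maximal. Fix a maximal term in each
  other row and move only row i: leaving it unassigned or assigning it to a column \<open>\<alpha>\<close> gives monomials
  with exponents c and \<open>c + e\<^sub>\<alpha>\<close> which attain the same value of the product. Equating them
  leaves \<open>l \<alpha>\<close> as the difference of their coefficients, up to sign.\<close>

lemma row_eq_basic_differences:
  assumes i: "i < n"
  shows "\<exists>c. (\<forall>\<alpha>\<ge>r. c \<alpha> = 0) \<and> (\<Sum>\<alpha><r. c \<alpha>) < n \<and>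
    (\<forall>\<alpha><r. M (i, \<alpha>) = basic_value n r (c(\<alpha> := Suc (c \<alpha>))) M - basic_value n r c M)"
proof -
  define l where "l \<beta> = - M (i, \<beta>)" for \<beta>
  obtain a where a: "\<And>j. hinge r M l j = (if a j < r then M (j, a j) + l (a j) else 0)"
    using hinge_attained[of r M l] by metis
  have hi: "hinge r M l i = 0"
    using hinge_nonneg[of r M l i] hinge_le[of 0 r M i l] by (simp add: l_def)
  \<comment> \<open>Row \<open>i\<close> attains its hinge in every column and also unassigned (column \<open>r\<close>).\<close>
  let ?c = "\<lambda>k. column_counts n r (a(i := k))"
  have tight: "basic_value n r (?c k) M + (\<Sum>\<alpha><r. real (?c k \<alpha>) * l \<alpha>) = (\<Sum>j<n. hinge r M l j)" for k
  proof (rule basic_value_tight)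
    fix j show "hinge r M l j = (if (a(i := k)) j < r then M (j, (a(i := k)) j) + l ((a(i := k)) j) else 0)"
      using a[of j] hi by (cases "j = i") (simp_all add: l_def)
  qed
  have upd: "?c \<alpha> = (?c r)(\<alpha> := Suc (?c r \<alpha>))" if \<alpha>: "\<alpha> < r" for \<alpha>
  proof
    fix \<beta>
    show "?c \<alpha> \<beta> = ((?c r)(\<alpha> := Suc (?c r \<alpha>))) \<beta>"
    proof (cases "\<beta> = \<alpha>")
      case True
      have "{j \<in> {..<n}. (a(i := \<alpha>)) j = \<alpha>} = insert i {j \<in> {..<n}. (a(i := r)) j = \<alpha>}"
        using i \<alpha> by auto
      then show ?thesis using True \<alpha> by (simp add: column_counts_def)
    next
      case False
      have "{j \<in> {..<n}. (a(i := \<alpha>)) j = \<beta>} = {j \<in> {..<n}. (a(i := r)) j = \<beta>}" if "\<beta> < r"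
        using False that by auto
      then show ?thesis using False by (simp add: column_counts_def)
    qed
  qed
  have "M (i, \<alpha>) = basic_value n r ((?c r)(\<alpha> := Suc (?c r \<alpha>))) M - basic_value n r (?c r) M"
    if \<alpha>: "\<alpha> < r" for \<alpha>
  proof -
    have "(\<Sum>\<beta><r. real (?c \<alpha> \<beta>) * l \<beta>) = (\<Sum>\<beta><r. real (?c r \<beta>) * l \<beta> + (if \<beta> = \<alpha> then l \<beta> else 0))"
      unfolding upd[OF \<alpha>] by (intro sum.cong) (auto simp: distrib_right)
    also have "\<dots> = (\<Sum>\<beta><r. real (?c r \<beta>) * l \<beta>) + l \<alpha>"
      using \<alpha> by (simp add: sum.distrib)
    finally show ?thesis
      using tight[of \<alpha>] tight[of r] unfolding upd[OF \<alpha>] by (simp add: l_def)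
  qed
  moreover have "(\<Sum>\<alpha><r. ?c r \<alpha>) < n"
  proof -
    have "card {j \<in> {..<n}. (a(i := r)) j < r} < card {..<n}"
      using i by (intro psubset_card_mono) auto
    then show ?thesis by (simp only: sum_column_counts card_lessThan)
  qed
  moreover have "\<forall>\<alpha>\<ge>r. ?c r \<alpha> = 0" by (simp add: column_counts_def)
  ultimately show ?thesis by (intro exI[of _ "?c r"]) blast
qed

section \<open>The basic map determines the rows up to a Lipschitz error\<close>

text \<open>
  Move \<open>l\<close> from \<open>- M (i, _) - 2 * \<delta>\<close> to \<open>- M (i, _)\<close>. Every hinge grows by at most \<open>2 * \<delta>\<close>, and the
  hinge of row \<open>i\<close> ends at 0, so it does not grow. A row of \<open>M'\<close> with some coordinate at least
  \<open>2 * \<delta>\<close> above that of row \<open>i\<close> grows by at least \<open>2 * \<delta>\<close>. If all rows of \<open>M'\<close> were of this kind, the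
  two products would drift apart by \<open>2 * \<delta>\<close> during the move, against the bound \<open>\<delta>\<close> at both ends.
  So some row of \<open>M'\<close> lies below row \<open>i\<close> up to \<open>2 * \<delta>\<close> in every coordinate. Its coordinate sum is
  not smaller, hence no coordinate can lie far below.
\<close>

lemma near_row:
  assumes fin: "finite I" "finite J" and card: "card I = card J" and i: "i \<in> I"
    and close: "\<And>l. \<bar>(\<Sum>i\<in>I. hinge r M l i) - (\<Sum>j\<in>J. hinge r M' l j)\<bar> < \<delta>"
    and least: "\<And>j. j \<in> J \<Longrightarrow> (\<Sum>\<beta><r. M (i, \<beta>)) \<le> (\<Sum>\<beta><r. M' (j, \<beta>))"
  shows "\<exists>j\<in>J. \<forall>\<beta><r. \<bar>M (i, \<beta>) - M' (j, \<beta>)\<bar> \<le> 2 * real r * \<delta>"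
proof -
  define l where "l \<beta> = - M (i, \<beta>) - 2 * \<delta>" for \<beta>
  define l' where "l' \<beta> = - M (i, \<beta>)" for \<beta>
  have \<delta>: "0 < \<delta>" using close[of l] by linarith
  have hi: "hinge r M l' i = 0"
    using hinge_nonneg[of r M l' i] hinge_le[of 0 r M i l'] by (simp add: l'_def)
  have "\<exists>j\<in>J. \<forall>\<beta><r. M' (j, \<beta>) < M (i, \<beta>) + 2 * \<delta>"
  proof (rule ccontr)
    assume "\<not> ?thesis"
    then have far: "\<exists>\<beta><r. M (i, \<beta>) + 2 * \<delta> \<le> M' (j, \<beta>)" if "j \<in> J" for j
      using that by (meson not_less)
    have "hinge r M' l j + 2 * \<delta> \<le> hinge r M' l' j" if j: "j \<in> J" for j
    proof -
      obtain k where k: "hinge r M' l j = (if k < r then M' (j, k) + l k else 0)"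
        using hinge_attained by blast
      show ?thesis
      proof (cases "k < r")
        case True
        then show ?thesis using k hinge_ge[of k r M' j l'] by (simp add: l_def l'_def)
      next
        case False
        obtain \<beta> where "\<beta> < r" "M (i, \<beta>) + 2 * \<delta> \<le> M' (j, \<beta>)" using far[OF j] by blast
        then show ?thesis using False k hinge_ge[of \<beta> r M' j l'] by (simp add: l'_def)
      qed
    qed
    then have "(\<Sum>j\<in>J. hinge r M' l j + 2 * \<delta>) \<le> (\<Sum>j\<in>J. hinge r M' l' j)"
      by (rule sum_mono)
    then have up: "(\<Sum>j\<in>J. hinge r M' l j) + card J * (2 * \<delta>) \<le> (\<Sum>j\<in>J. hinge r M' l' j)"
      by (simp add: sum.distrib)
    have "hinge r M l' k \<le> hinge r M l k + 2 * \<delta>" for k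
      using \<delta> by (intro hinge_Lipschitz) (auto simp: l_def l'_def)
    then have "(\<Sum>k\<in>I - {i}. hinge r M l' k) \<le> (\<Sum>k\<in>I - {i}. hinge r M l k + 2 * \<delta>)"
      by (intro sum_mono)
    moreover have "(\<Sum>k\<in>I. hinge r M l' k) = (\<Sum>k\<in>I - {i}. hinge r M l' k)"
      using hi by (simp add: sum.remove[OF fin(1) i])
    moreover have "(\<Sum>k\<in>I - {i}. hinge r M l k) \<le> (\<Sum>k\<in>I. hinge r M l k)"
      using fin by (intro sum_mono2 hinge_nonneg) auto
    ultimately have "(\<Sum>k\<in>I. hinge r M l' k) \<le> (\<Sum>k\<in>I. hinge r M l k) + real (card (I - {i})) * (2 * \<delta>)"
      by (simp add: sum.distrib)
    moreover have "real (card I) = real (card (I - {i})) + 1"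
      using card_Suc_Diff1[OF fin(1) i] by linarith
    ultimately show False
      using up close[of l] close[of l'] card by (simp add: distrib_right)
  qed
  then obtain j where j: "j \<in> J" and upper: "\<And>\<beta>. \<beta> < r \<Longrightarrow> M' (j, \<beta>) < M (i, \<beta>) + 2 * \<delta>" by blast
  have "\<bar>M (i, \<beta>) - M' (j, \<beta>)\<bar> \<le> 2 * real r * \<delta>" if \<beta>: "\<beta> < r" for \<beta>
  proof -
    have "(\<Sum>\<gamma>\<in>{..<r} - {\<beta>}. M' (j, \<gamma>)) \<le> (\<Sum>\<gamma>\<in>{..<r} - {\<beta>}. M (i, \<gamma>) + 2 * \<delta>)"
      using upper by (intro sum_mono) (auto simp: less_imp_le)
    also have "\<dots> = (\<Sum>\<gamma>\<in>{..<r} - {\<beta>}. M (i, \<gamma>)) + (real r - 1) * (2 * \<delta>)"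
      using \<beta> by (simp add: sum.distrib of_nat_diff)
    finally have "M (i, \<beta>) \<le> M' (j, \<beta>) + (real r - 1) * (2 * \<delta>)"
      using least[OF j] \<beta> sum.remove[of "{..<r}" \<beta> "\<lambda>\<gamma>. M (i, \<gamma>)"]
        sum.remove[of "{..<r}" \<beta> "\<lambda>\<gamma>. M' (j, \<gamma>)"] by simp
    then have "M (i, \<beta>) - M' (j, \<beta>) \<le> 2 * real r * \<delta>"
      using \<delta> by (simp add: algebra_simps)
    moreover have "1 * \<delta> \<le> real r * \<delta>"
      using \<delta> \<beta> by (intro mult_right_mono) auto
    ultimately show ?thesis using upper[OF \<beta>] by simp
  qed
  with j show ?thesis by blast
qed

text \<open>The row of least coordinate sum among all rows of both matrices serves in the previous lemma,
  with the two matrices exchanged if necessary.\<close>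

lemma near_pair:
  assumes fin: "finite I" "finite J" and card: "card I = card J" and ne: "I \<noteq> {}"
    and close: "\<And>l. \<bar>(\<Sum>i\<in>I. hinge r M l i) - (\<Sum>j\<in>J. hinge r M' l j)\<bar> < \<delta>"
  shows "\<exists>i\<in>I. \<exists>j\<in>J. \<forall>\<beta><r. \<bar>M (i, \<beta>) - M' (j, \<beta>)\<bar> \<le> 2 * real r * \<delta>"
proof -
  let ?s = "\<lambda>i. \<Sum>\<beta><r. M (i, \<beta>)" and ?s' = "\<lambda>j. \<Sum>\<beta><r. M' (j, \<beta>)"
  have "J \<noteq> {}" using card ne fin by auto
  obtain i where i: "i \<in> I" "\<And>k. k \<in> I \<Longrightarrow> ?s i \<le> ?s k"
    using arg_min_if_finite[OF fin(1) ne, of ?s] by (meson not_less)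
  obtain j where j: "j \<in> J" "\<And>k. k \<in> J \<Longrightarrow> ?s' j \<le> ?s' k"
    using arg_min_if_finite[OF fin(2) \<open>J \<noteq> {}\<close>, of ?s'] by (meson not_less)
  show ?thesis
  proof (cases "?s i \<le> ?s' j")
    case True
    then have "\<And>k. k \<in> J \<Longrightarrow> ?s i \<le> ?s' k" using j(2) order_trans by blast
    then show ?thesis using near_row[OF fin card i(1) close] i(1) by blast
  next
    case False
    then have "\<And>k. k \<in> I \<Longrightarrow> ?s' j \<le> ?s k" using i(2) by (meson less_imp_le not_le order_trans)
    moreover have "\<And>l. \<bar>(\<Sum>j\<in>J. hinge r M' l j) - (\<Sum>i\<in>I. hinge r M l i)\<bar> < \<delta>"
      using close by (simp add: abs_minus_commute)
    ultimately have "\<exists>i\<in>I. \<forall>\<beta><r. \<bar>M' (j, \<beta>) - M (i, \<beta>)\<bar> \<le> 2 * real r * \<delta>"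
      using near_row[OF fin(2,1) card[symmetric] j(1)] by blast
    then show ?thesis using j(1) by (metis abs_minus_commute)
  qed
qed

text \<open>Removing a pair of rows at distance \<open>2 * r * \<delta>\<close> changes the difference of the products by at
  most as much, since hinges are 1-Lipschitz in the row. So each removal multiplies the bound by
  \<open>2 * r + 1\<close>.\<close>

lemma near_matching:
  assumes "finite I" "finite J" "card I = card J"
    and "\<And>l. \<bar>(\<Sum>i\<in>I. hinge r M l i) - (\<Sum>j\<in>J. hinge r M' l j)\<bar> < \<delta>"
  shows "\<exists>\<sigma>. bij_betw \<sigma> I J \<and>
    (\<forall>i\<in>I. \<forall>\<beta><r. \<bar>M (i, \<beta>) - M' (\<sigma> i, \<beta>)\<bar> \<le> (2 * real r + 1) ^ card I * \<delta>)"
  using assms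
proof (induction "card I" arbitrary: I J \<delta>)
  case 0
  then show ?case by (auto simp: bij_betw_def)
next
  case (Suc m)
  note close = Suc.prems(4)
  have \<delta>: "0 < \<delta>" using close[of "\<lambda>_. 0"] by linarith
  have "I \<noteq> {}" using Suc by auto
  then obtain i j where i: "i \<in> I" and j: "j \<in> J"
    and ij: "\<And>\<beta>. \<beta> < r \<Longrightarrow> \<bar>M (i, \<beta>) - M' (j, \<beta>)\<bar> \<le> 2 * real r * \<delta>"
    using near_pair[OF Suc.prems(1-3) _ close] by blast
  have nn: "0 \<le> 2 * real r * \<delta>" using \<delta> by simp
  have "\<bar>(\<Sum>i\<in>I - {i}. hinge r M l i) - (\<Sum>j\<in>J - {j}. hinge r M' l j)\<bar> < (2 * real r + 1) * \<delta>" for l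
  proof -
    have "hinge r M l i \<le> hinge r M' l j + 2 * real r * \<delta>"
      using ij by (intro hinge_Lipschitz nn) fastforce
    moreover have "hinge r M' l j \<le> hinge r M l i + 2 * real r * \<delta>"
      using ij by (intro hinge_Lipschitz nn) fastforce
    ultimately show ?thesis
      using close[of l] sum.remove[OF Suc.prems(1) i, of "hinge r M l"]
        sum.remove[OF Suc.prems(2) j, of "hinge r M' l"]
      by (simp add: distrib_right abs_less_iff)
  qed
  moreover have c: "m = card (I - {i})" "card (I - {i}) = card (J - {j})"
    using Suc i j by auto
  ultimately obtain \<sigma> where bij: "bij_betw \<sigma> (I - {i}) (J - {j})"
    and \<sigma>: "\<And>k \<beta>. k \<in> I - {i} \<Longrightarrow> \<beta> < r \<Longrightarrow>
        \<bar>M (k, \<beta>) - M' (\<sigma> k, \<beta>)\<bar> \<le> (2 * real r + 1) ^ m * ((2 * real r + 1) * \<delta>)"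
    using Suc.hyps(1)[OF c(1) _ _ c(2), of "(2 * real r + 1) * \<delta>"] Suc.prems(1,2) by auto
  let ?\<sigma> = "\<sigma>(i := j)"
  have "bij_betw ?\<sigma> (I - {i}) (J - {j})"
    using bij by (rule bij_betw_cong[THEN iffD1, rotated]) auto
  then have "bij_betw ?\<sigma> I J"
    using notIn_Un_bij_betw3[of i "I - {i}" ?\<sigma> "J - {j}"] i j by (simp add: insert_absorb)
  moreover have "\<bar>M (k, \<beta>) - M' (?\<sigma> k, \<beta>)\<bar> \<le> (2 * real r + 1) ^ card I * \<delta>"
    if k: "k \<in> I" and \<beta>: "\<beta> < r" for k \<beta>
  proof (cases "k = i")
    case True
    have "2 * real r + 1 \<le> (2 * real r + 1) ^ card I"
      using Suc.hyps(2) by (intro self_le_power) auto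
    then have "(2 * real r + 1) * \<delta> \<le> (2 * real r + 1) ^ card I * \<delta>"
      using \<delta> by (intro mult_right_mono) auto
    then show ?thesis using True ij[OF \<beta>] \<delta> by (simp add: distrib_right)
  next
    case False
    then show ?thesis using \<sigma>[of k \<beta>] k \<beta> Suc.hyps(2)[symmetric] by (simp add: mult_ac)
  qed
  ultimately show ?case by blast
qed

text \<open>An invariant function cannot see the permutation in the matching of the rows, so only the
  distances of matched rows matter. In particular \<open>f\<close> takes equal values where
  all basic values agree.\<close>

lemma invariant_Lipschitz_in_basic_values:
  assumes f: "tropical_rational ({..<n} \<times> {..<r}) f" and inv: "row_invariant n f"
  obtains N :: nat where "\<And>M M'. f M' \<le> f M
    + real N * (\<Sum>c\<in>basic_indices n r. \<bar>basic_value n r c M - basic_value n r c M'\<bar>)"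
proof -
  obtain L where L: "L \<ge> 0" "\<And>z z' s. (\<And>i. i \<in> {..<n} \<times> {..<r} \<Longrightarrow> \<bar>z i - z' i\<bar> \<le> s) \<Longrightarrow> f z \<le> f z' + L * s"
    using tropical_rational_Lipschitz[OF f] by blast
  define C where "C = L * (2 * real r + 1) ^ n"
  have C: "0 \<le> C" using L by (simp add: C_def)
  have "f M' \<le> f M + real (nat \<lceil>C\<rceil>) * (\<Sum>c\<in>basic_indices n r. \<bar>basic_value n r c M - basic_value n r c M'\<bar>)"
    (is "_ \<le> _ + _ * ?e") for M M'
  proof -
    have "?e \<ge> 0" by (intro sum_nonneg) auto
    have fin: "finite (basic_indices n r)" by (rule finite_basic_indices)
    have b: "\<bar>basic_value n r c M - basic_value n r c M'\<bar> \<le> ?e" if "c \<in> basic_indices n r" for c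
      using that fin by (intro member_le_sum[of c _ "\<lambda>c. \<bar>basic_value n r c M - basic_value n r c M'\<bar>"]) auto
    have G: "\<bar>(\<Sum>i<n. hinge r M' l i) - (\<Sum>i<n. hinge r M l i)\<bar> \<le> ?e" for l
    proof -
      have "(\<Sum>i<n. hinge r M l i) \<le> (\<Sum>i<n. hinge r M' l i) + ?e"
        using b by (intro sum_hinge_le_of_basic_values \<open>?e \<ge> 0\<close>) (fastforce simp: abs_le_iff)
      moreover have "(\<Sum>i<n. hinge r M' l i) \<le> (\<Sum>i<n. hinge r M l i) + ?e"
        using b by (intro sum_hinge_le_of_basic_values \<open>?e \<ge> 0\<close>) (fastforce simp: abs_le_iff)
      ultimately show ?thesis by linarith
    qed
    \<comment> \<open>The matching needs a strict bound on the difference of the products, hence the slack \<open>\<eta>\<close>.\<close>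
    have slack: "f M' \<le> f M + C * (?e + \<eta>)" if "\<eta> > 0" for \<eta>
    proof -
      have "\<And>l. \<bar>(\<Sum>i<n. hinge r M' l i) - (\<Sum>i<n. hinge r M l i)\<bar> < ?e + \<eta>"
        using G that by (meson add_strict_increasing le_less_trans less_add_same_cancel1 order_refl)
      then obtain \<sigma> where bij: "bij_betw \<sigma> {..<n} {..<n}" and
        \<sigma>: "\<And>i \<beta>. i < n \<Longrightarrow> \<beta> < r \<Longrightarrow> \<bar>M' (i, \<beta>) - M (\<sigma> i, \<beta>)\<bar> \<le> (2 * real r + 1) ^ n * (?e + \<eta>)"
        using near_matching[of "{..<n}" "{..<n}" r M' M "?e + \<eta>"] by auto
      define \<pi> where "\<pi> i = (if i < n then \<sigma> i else i)" for i
      have "bij_betw \<pi> {..<n} {..<n}"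
        using bij by (rule bij_betw_cong[THEN iffD1, rotated]) (simp add: \<pi>_def)
      then have perm: "\<pi> permutes {..<n}"
        by (rule bij_imp_permutes) (simp add: \<pi>_def)
      have "f M' \<le> f (\<lambda>(i, \<alpha>). M (\<pi> i, \<alpha>)) + L * ((2 * real r + 1) ^ n * (?e + \<eta>))"
        using \<sigma> by (intro L) (auto simp: \<pi>_def)
      also have "f (\<lambda>(i, \<alpha>). M (\<pi> i, \<alpha>)) = f M"
        using inv perm by (auto simp: row_invariant_def)
      finally show ?thesis by (simp add: C_def mult.assoc)
    qed
    have "f M' \<le> f M + C * ?e"
    proof (rule field_le_epsilon)
      fix \<eta> :: real assume "\<eta> > 0"
      then have "f M' \<le> f M + C * (?e + \<eta> / (C + 1))"
        using C by (intro slack) auto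
      also have "C * (?e + \<eta> / (C + 1)) \<le> C * ?e + \<eta>"
        using C \<open>\<eta> > 0\<close> by (simp add: field_simps)
      finally show "f M' \<le> f M + C * ?e + \<eta>" by simp
    qed
    also have "C * ?e \<le> real (nat \<lceil>C\<rceil>) * ?e"
      using \<open>?e \<ge> 0\<close> by (intro mult_right_mono) linarith+
    finally show ?thesis by simp
  qed
  then show ?thesis by (rule that)
qed

section \<open>Generation by the basic values\<close>

text \<open>The matrix whose row \<open>i\<close> is read off from \<open>y\<close> by the reconstruction formula with the vector
  \<open>\<tau> i\<close>. The vector 0 has no coordinate in \<open>y\<close>; the value 0 supplied outside the index set is its
  basic value.\<close>

definition candidate_matrix ::
  "nat \<Rightarrow> nat \<Rightarrow> (nat \<Rightarrow> nat \<Rightarrow> nat) \<Rightarrow> ((nat \<Rightarrow> nat) \<Rightarrow> real) \<Rightarrow> (nat \<times> nat \<Rightarrow> real)" where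
  "candidate_matrix n r \<tau> y = (\<lambda>(i, \<alpha>).
     (let z = (\<lambda>c. if c \<in> basic_indices n r then y c else 0)
      in z ((\<tau> i)(\<alpha> := Suc (\<tau> i \<alpha>))) - z (\<tau> i)))"

lemma tropical_rational_candidate_matrix:
  "tropical_rational (basic_indices n r) (\<lambda>y. candidate_matrix n r \<tau> y p)"
proof -
  have "tropical_rational (basic_indices n r) (\<lambda>y. if c \<in> basic_indices n r then y c else 0)" for c
    by (cases "c \<in> basic_indices n r")
       (simp_all add: tropical_rational_coordinate tropical_rational_const finite_basic_indices)
  then show ?thesis
    unfolding candidate_matrix_def Let_def case_prod_beta by (intro tropical_rational_diff)
qed

lemma basic_map_eq_basic_value:
  "c \<in> basic_indices n r \<Longrightarrow> basic_map n r M c = basic_value n r c M"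
  by (simp add: basic_map_def)

lemma basic_map_extend_zero:
  assumes "\<forall>\<alpha>\<ge>r. c \<alpha> = 0" "(\<Sum>\<alpha><r. c \<alpha>) \<le> n"
  shows "(if c \<in> basic_indices n r then basic_map n r M c else 0) = basic_value n r c M"
proof (cases "c \<in> basic_indices n r")
  case False
  then have "c \<alpha> = 0" for \<alpha>
    using assms by (cases "\<alpha> < r") (auto simp: basic_indices_def)
  then have "c = (\<lambda>_. 0)" by auto
  then show ?thesis using False by (simp add: basic_value_zero)
qed (simp add: basic_map_def)

text \<open>The reconstruction of the rows, with one vector for each row. These vectors come from a finite
  set that does not depend on \<open>M\<close>.\<close>

lemma candidate_matrix_exists:
  obtains \<tau> where "\<tau> \<in> {..<n} \<rightarrow>\<^sub>E insert (\<lambda>_. 0) (basic_indices n r)"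
    and "\<And>i \<alpha>. i < n \<Longrightarrow> \<alpha> < r \<Longrightarrow> candidate_matrix n r \<tau> (basic_map n r M) (i, \<alpha>) = M (i, \<alpha>)"
proof -
  obtain \<tau> where \<tau>: "\<And>i. i < n \<Longrightarrow> (\<forall>\<alpha>\<ge>r. \<tau> i \<alpha> = 0) \<and> (\<Sum>\<alpha><r. \<tau> i \<alpha>) < n \<and>
      (\<forall>\<alpha><r. M (i, \<alpha>) = basic_value n r ((\<tau> i)(\<alpha> := Suc (\<tau> i \<alpha>))) M - basic_value n r (\<tau> i) M)"
    using row_eq_basic_differences[of _ n r M] by metis
  show ?thesis
  proof
    have "\<tau> i \<in> insert (\<lambda>_. 0) (basic_indices n r)" if "i < n" for i
    proof (cases "(\<Sum>\<alpha><r. \<tau> i \<alpha>) = 0")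
      case True
      then have "\<tau> i \<alpha> = 0" for \<alpha> using \<tau>[OF that] by (cases "\<alpha> < r") auto
      then show ?thesis by auto
    next
      case False
      then show ?thesis using \<tau>[OF that] by (auto simp: basic_indices_def)
    qed
    then show "restrict \<tau> {..<n} \<in> {..<n} \<rightarrow>\<^sub>E insert (\<lambda>_. 0) (basic_indices n r)" by auto
    fix i \<alpha> assume i: "i < n" and \<alpha>: "\<alpha> < r"
    have "(\<Sum>\<beta><r. ((\<tau> i)(\<alpha> := Suc (\<tau> i \<alpha>))) \<beta>) = Suc (\<Sum>\<beta><r. \<tau> i \<beta>)"
    proof -
      have "(\<Sum>\<beta><r. ((\<tau> i)(\<alpha> := Suc (\<tau> i \<alpha>))) \<beta>) = (\<Sum>\<beta><r. \<tau> i \<beta> + (if \<beta> = \<alpha> then 1 else 0))"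
        by (intro sum.cong) auto
      then show ?thesis using \<alpha> by (simp add: sum.distrib)
    qed
    then have "(\<Sum>\<beta><r. ((\<tau> i)(\<alpha> := Suc (\<tau> i \<alpha>))) \<beta>) \<le> n"
      using \<tau>[OF i] by simp
    then show "candidate_matrix n r (restrict \<tau> {..<n}) (basic_map n r M) (i, \<alpha>) = M (i, \<alpha>)"
      using \<tau>[OF i] i \<alpha> unfolding candidate_matrix_def Let_def prod.case
      by (subst (1 2) basic_map_extend_zero) auto
  qed
qed

text \<open>The function \<open>g\<close> is a maximum over all candidate matrices, where a candidate is penalised by
  the distance between its basic values and the given ones. By the Lipschitz bound, a penalty
  factor \<open>N\<close> keeps the terms of wrong candidates below \<open>f M\<close>.\<close>

lemma invariant_factors_through_basic_map:
  assumes f: "tropical_rational ({..<n} \<times> {..<r}) f" and inv: "row_invariant n f"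
  shows "\<exists>g. tropical_rational (basic_indices n r) g \<and> f = g \<circ> basic_map n r"
proof -
  let ?I = "{..<n} \<times> {..<r}" and ?K = "basic_indices n r"
  obtain N :: nat where N: "\<And>M M'. f M' \<le> f M
      + real N * (\<Sum>c\<in>?K. \<bar>basic_value n r c M - basic_value n r c M'\<bar>)"
    using invariant_Lipschitz_in_basic_values[OF f inv] by blast
  define T where "T = {..<n} \<rightarrow>\<^sub>E insert (\<lambda>_. 0) ?K"
  have T: "finite T" "T \<noteq> {}"
    unfolding T_def by (auto simp: finite_PiE finite_basic_indices PiE_eq_empty_iff)
  define h where "h \<tau> y = f (candidate_matrix n r \<tau> y)
      - real N * (\<Sum>c\<in>?K. \<bar>y c - basic_value n r c (candidate_matrix n r \<tau> y)\<bar>)" for \<tau> y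
  define g where "g y = Max ((\<lambda>\<tau>. h \<tau> y) ` T)" for y
  have "tropical_rational ?K (h \<tau>)" for \<tau>
  proof -
    have "tropical_rational ?K (\<lambda>y. basic_value n r c (candidate_matrix n r \<tau> y))" if "c \<in> ?K" for c
      using that by (intro tropical_rational_compose[OF tropical_rational_basic_value]
          tropical_rational_candidate_matrix) (auto simp: basic_indices_def)
    then show ?thesis
      unfolding h_def
      by (intro tropical_rational_diff tropical_rational_compose[OF f]
          tropical_rational_candidate_matrix tropical_rational_of_nat_mult tropical_rational_sum
          tropical_rational_abs tropical_rational_coordinate finite_basic_indices)
  qed
  then have "tropical_rational ?K g"
    unfolding g_def by (intro tropical_rational_Max T)
  moreover have "f M = g (basic_map n r M)" for M
  proof (rule antisym)
    have "h \<tau> (basic_map n r M) \<le> f M" for \<tau>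
      using N[of "candidate_matrix n r \<tau> (basic_map n r M)" M]
      by (simp add: h_def basic_map_eq_basic_value)
    then show "g (basic_map n r M) \<le> f M"
      unfolding g_def using T by (intro Max.boundedI) auto
    obtain \<tau> where \<tau>: "\<tau> \<in> T"
      and eq: "\<And>i \<alpha>. i < n \<Longrightarrow> \<alpha> < r \<Longrightarrow> candidate_matrix n r \<tau> (basic_map n r M) (i, \<alpha>) = M (i, \<alpha>)"
      using candidate_matrix_exists unfolding T_def by metis
    let ?M' = "candidate_matrix n r \<tau> (basic_map n r M)"
    have same: "F ?M' = F M" if "tropical_rational ?I F" for F
      using tropical_rational_cong[OF that, of ?M' M] eq by auto
    have "basic_value n r c ?M' = basic_value n r c M" if "c \<in> ?K" for c
      using that by (intro same tropical_rational_basic_value) (auto simp: basic_indices_def)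
    then have "h \<tau> (basic_map n r M) = f M"
      by (simp add: h_def same[OF f] basic_map_eq_basic_value)
    then show "f M \<le> g (basic_map n r M)"
      unfolding g_def using T \<tau> by (metis (no_types, lifting) Max_ge finite_imageI imageI)
  qed
  ultimately show ?thesis by (intro exI[of _ g]) auto
qed

theorem theorem1p1:
  fixes n r :: nat
  assumes "0 < n" and "0 < r"
  shows "basic_semifield n r = invariant_semifield n r"
proof
  show "invariant_semifield n r \<subseteq> basic_semifield n r"
    using invariant_factors_through_basic_map
    unfolding invariant_semifield_def basic_semifield_def by blast
  show "basic_semifield n r \<subseteq> invariant_semifield n r"
  proof
    fix f assume "f \<in> basic_semifield n r"
    then obtain g where g: "tropical_rational (basic_indices n r) g" and f: "f = g \<circ> basic_map n r"
      unfolding basic_semifield_def by blast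
    have "tropical_rational ({..<n} \<times> {..<r}) (\<lambda>M. g (basic_map n r M))"
    proof (rule tropical_rational_compose[OF g])
      fix c assume "c \<in> basic_indices n r"
      then show "tropical_rational ({..<n} \<times> {..<r}) (\<lambda>M. basic_map n r M c)"
        by (simp add: basic_map_def tropical_rational_basic_value basic_indices_def)
    qed
    moreover have "basic_map n r (\<lambda>(i, \<alpha>). M (\<pi> i, \<alpha>)) = basic_map n r M"
      if "\<pi> permutes {..<n}" for \<pi> M
      using row_invariant_basic_value that by (auto simp: basic_map_def row_invariant_def)
    ultimately show "f \<in> invariant_semifield n r"
      by (auto simp: invariant_semifield_def row_invariant_def f comp_def)
  qed
qed

end
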